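(* (a) Let $K\subset\mathbb R^2$ be a convex body with $0\in\operatorname{int}(K)$ satisfying $\rho_K(\pm(1,0)^T)=h_K(\pm(1,0)^T)=e^{\pm\lambda}$ for some $\lambda\in\mathbb R$ (that is, the equalities hold with upper signs and with lower signs). Then $(K\cap H^+)\cup(K^*\cap H^-)$ is a self-dual convex body. (b) For every planar self-dual convex body $K\subset\mathbb R^2$ there exists a rotation $\psi\in SO(2)$ such that $\psi(K)$ satisfies the assumptions in (a), i.e. $\psi(K)$ is a convex body with $0\in\operatorname{int}(\psi(K))$ and $\rho_{\psi(K)}(\pm(1,0)^T)=h_{\psi(K)}(\pm(1,0)^T)=e^{\pm\lambda}$ for some $\lambda\in\mathbb R$.
   Context: $\mathbb R^2$ carries the standard scalar product. A convex body is a compact convex set. $H^\pm=\{(x,y)^T\in\mathbb R^2\mid\pm y\ge 0\}$. The support function is $h_K(u)=\sup\{\langle x,u\rangle\mid x\in K\}$; the radial function of a convex body $K$ with $0\in\operatorname{int}(K)$ is $\rho_K(u)=\sup\{\lambda\ge 0\mid\lambda u\in K\}$. The dual of $K$ is $K^*=\{u\in\mathbb R^2\mid 1+\langle u,v\rangle\ge 0\ \forall v\in K\}$, and $K$ is self-dual if $K^*=K$. *)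

theory Defs
  imports "HOL-Analysis.Analysis"
begin

definition convex_body :: "(real^2) set \<Rightarrow> bool" where
  "convex_body K \<longleftrightarrow> compact K \<and> convex K"

definition upper_half :: "(real^2) set" where
  "upper_half = {p. p $ 2 \<ge> 0}"

definition lower_half :: "(real^2) set" where
  "lower_half = {p. - (p $ 2) \<ge> 0}"

(* Sup on the reals is only meaningful for nonempty sets that are bounded above: this holds
   below if K is nonempty and bounded and, for the radial function, if also 0 : K and u ~= 0. *)

definition support_function :: "(real^2) set \<Rightarrow> real^2 \<Rightarrow> real" where
  "support_function K u = Sup {x \<bullet> u | x. x \<in> K}"

definition radial_function :: "(real^2) set \<Rightarrow> real^2 \<Rightarrow> real" where
  "radial_function K u = Sup {c. c \<ge> 0 \<and> c *\<^sub>R u \<in> K}"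

(* Because of the plus sign this is the reflection in 0 of the usual polar set. *)

definition dual_body :: "(real^2) set \<Rightarrow> (real^2) set" where
  "dual_body K = {u. \<forall>v\<in>K. 1 + u \<bullet> v \<ge> 0}"

definition self_dual :: "(real^2) set \<Rightarrow> bool" where
  "self_dual K \<longleftrightarrow> dual_body K = K"

definition axis_normalized :: "(real^2) set \<Rightarrow> bool" where
  "axis_normalized K \<longleftrightarrow>
     convex_body K \<and> 0 \<in> interior K \<and>
     (\<exists>l::real.
        radial_function K (vector [1, 0]) = support_function K (vector [1, 0]) \<and>
        support_function K (vector [1, 0]) = exp l \<and>
        radial_function K (- vector [1, 0]) = support_function K (- vector [1, 0]) \<and>
        support_function K (- vector [1, 0]) = exp (- l))"

end

theory Submission
  imports Defs
begin

text \<open>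
  Write \<open>e\<close> for the first unit vector and call \<open>K\<close> normalized with \<open>a > 0\<close> and \<open>b = 1 / a\<close> if
  \<open>K\<close> lies in the strip \<open>- b \<le> x \<le> a\<close> and contains \<open>a e\<close> and \<open>- b e\<close>. This is what the four
  equations on the radial and support functions say, and duality exchanges the two
  conditions (\<open>normalized_dual\<close>), so the dual is normalized with the same numbers.

  For the gluing, both bodies therefore meet the horizontal axis in the segment from \<open>- b e\<close> to
  \<open>a e\<close>, and a segment joining a point of the upper part to a point of the lower part crosses the
  axis inside the strip, hence inside both bodies. That gives convexity (\<open>convex_glued\<close>).
  Two points in the strip on the same side of the axis have inner product at least
  \<open>- a b = - 1\<close> (\<open>strip_same_side\<close>), so testing points of the same half plane against each other
  gives no constraint beyond the strip; testing points of opposite half planes is the duality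
  between \<open>K\<close> and its dual. With the bipolar theorem this gives self-duality
  (\<open>self_dual_glued\<close>).

  For the converse, let \<open>p\<close> be a point of the self-dual body at maximal distance \<open>a\<close> from the
  origin. In the direction of \<open>p\<close> the radial and support functions are both \<open>a\<close>. Self-duality
  makes the support function in the direction \<open>- p\<close> and the radial function in the direction
  \<open>p\<close> reciprocal, and likewise with the roles of \<open>p\<close> and \<open>- p\<close> exchanged, so in the opposite
  direction both are \<open>1 / a\<close>. Rotating \<open>p\<close> onto the positive first axis finishes the proof.
\<close>

section \<open>Support, radial function and dual\<close>

lemma mem_dual_body: "u \<in> dual_body K \<longleftrightarrow> (\<forall>v\<in>K. 1 + u \<bullet> v \<ge> 0)"
  by (simp add: dual_body_def)

lemma inner_vec2: "u \<bullet> v = u $ 1 * v $ 1 + u $ 2 * (v :: real^2) $ 2"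
  by (simp add: inner_vec_def sum_2)

lemma dual_body_halfspaces: "dual_body K = (\<Inter>v\<in>K. {u. v \<bullet> u \<ge> - 1})"
  by (auto simp: dual_body_def inner_commute) (smt (verit))+

lemma closed_dual_body: "closed (dual_body K)"
  unfolding dual_body_halfspaces by (intro closed_INT ballI closed_halfspace_ge)

lemma convex_dual_body: "convex (dual_body K)"
  unfolding dual_body_halfspaces by (intro convex_INT convex_halfspace_ge)

lemma bounded_dual_body:
  assumes "0 \<in> interior K"
  shows "bounded (dual_body K)"
proof -
  obtain e where e: "e > 0" "cball 0 e \<subseteq> K"
    using assms by (meson mem_interior_cball)
  have "norm u \<le> 1 / e" if u: "u \<in> dual_body K" for u
  proof (cases "u = 0")
    case False
    have "- (e / norm u) *\<^sub>R u \<in> K"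
      using e False by (intro subsetD[OF e(2)]) auto
    with u have "0 \<le> 1 + u \<bullet> (- (e / norm u) *\<^sub>R u)"
      by (simp only: mem_dual_body)
    also have "\<dots> = 1 - e * norm u"
      using False by (simp add: dot_square_norm power2_eq_square)
    finally show ?thesis
      using e(1) by (simp add: field_simps)
  qed (use e in auto)
  then show ?thesis
    by (auto simp: bounded_iff)
qed

lemma zero_interior_dual_body:
  assumes "bounded K"
  shows "0 \<in> interior (dual_body K)"
proof -
  obtain M where M: "M > 0" "\<And>v. v \<in> K \<Longrightarrow> norm v \<le> M"
    using assms by (auto simp: bounded_pos)
  have "cball 0 (1 / M) \<subseteq> dual_body K"
  proof
    fix u :: "real^2" assume u: "u \<in> cball 0 (1 / M)"
    have "1 + u \<bullet> v \<ge> 0" if "v \<in> K" for v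
    proof -
      have "\<bar>u \<bullet> v\<bar> \<le> norm u * norm v"
        by (rule Cauchy_Schwarz_ineq2)
      also have "\<dots> \<le> 1 / M * M"
        using u M that by (intro mult_mono) auto
      also have "\<dots> = 1"
        using M(1) by simp
      finally show ?thesis by linarith
    qed
    then show "u \<in> dual_body K" by (simp add: mem_dual_body)
  qed
  then show ?thesis
    using M(1) by (auto simp: mem_interior_cball intro!: exI[of _ "1 / M"])
qed

text \<open>
  The bipolar theorem: a hyperplane strictly separating \<open>z\<close> from \<open>K\<close> misses the origin, so it
  can be scaled to the form \<open>1 + \<langle>x, w\<rangle> = 0\<close>, and \<open>w\<close> is a point of the dual that excludes \<open>z\<close>.
\<close>

lemma bipolar:
  assumes "closed K" "convex K" "0 \<in> K" and z: "z \<in> dual_body (dual_body K)"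
  shows "z \<in> K"
proof (rule ccontr)
  assume "z \<notin> K"
  then obtain w c where w: "w \<bullet> z < c" "\<And>x. x \<in> K \<Longrightarrow> w \<bullet> x > c"
    using separating_hyperplane_closed_point[of K z] assms by blast
  have c: "c < 0"
    using w(2)[OF assms(3)] by simp
  define w' where "w' = (- 1 / c) *\<^sub>R w"
  have "w' \<in> dual_body K"
    using w(2) c by (force simp: mem_dual_body w'_def field_simps dest: less_imp_le)
  with z have "0 \<le> 1 + z \<bullet> w'"
    by (simp only: mem_dual_body)
  with w(1) c show False
    by (simp add: w'_def field_simps inner_commute)
qed

lemma support_function_eqI:
  assumes "x \<in> K" "x \<bullet> u = c" "\<And>y. y \<in> K \<Longrightarrow> y \<bullet> u \<le> c"
  shows "support_function K u = c"
  unfolding support_function_def using assms by (intro cSup_eq_maximum) auto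

lemma inner_le_support_function:
  assumes "bounded K" "x \<in> K"
  shows "x \<bullet> u \<le> support_function K u"
proof -
  have "bounded ((\<lambda>x. x \<bullet> u) ` K)"
    using assms(1) by (intro bounded_linear_image bounded_linear_inner_left)
  then have "bdd_above {x \<bullet> u | x. x \<in> K}"
    by (simp add: bounded_imp_bdd_above Setcompr_eq_image)
  then show ?thesis
    unfolding support_function_def using assms(2) by (intro cSup_upper) auto
qed

lemma radial_function_eqI:
  assumes "c \<ge> 0" "c *\<^sub>R u \<in> K" "\<And>d. d \<ge> 0 \<Longrightarrow> d *\<^sub>R u \<in> K \<Longrightarrow> d \<le> c"
  shows "radial_function K u = c"
  unfolding radial_function_def using assms by (intro cSup_eq_maximum) auto

lemma radial_function_attained:
  assumes K: "compact K" "0 \<in> K" and u: "u \<noteq> 0"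
  shows "radial_function K u *\<^sub>R u \<in> K"
proof -
  let ?S = "{c. c \<ge> 0 \<and> c *\<^sub>R u \<in> K}"
  obtain M where M: "\<And>v. v \<in> K \<Longrightarrow> norm v \<le> M"
    using compact_imp_bounded[OF K(1)] by (auto simp: bounded_iff)
  have "c \<le> M / norm u" if "c \<in> ?S" for c
    using that M[of "c *\<^sub>R u"] u by (simp add: field_simps)
  then have "bdd_above ?S"
    by (rule bdd_aboveI)
  moreover have "closed ?S"
  proof -
    have "closed ((\<lambda>c. c *\<^sub>R u) -` K)"
      by (intro closed_vimage compact_imp_closed[OF K(1)] continuous_intros)
    moreover have "?S = {0..} \<inter> (\<lambda>c. c *\<^sub>R u) -` K"
      by auto
    ultimately show ?thesis
      by (simp add: closed_Int)
  qed
  moreover have "0 \<in> ?S"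
    using K(2) by simp
  ultimately have "Sup ?S \<in> ?S"
    by (intro closed_contains_Sup) auto
  then show ?thesis
    by (simp add: radial_function_def)
qed

section \<open>Gluing a normalized body and its dual along the axis\<close>

text \<open>
  The geometric content of the equations in \<^const>\<open>axis_normalized\<close>, with \<open>a = exp l\<close>. Convexity
  and compactness are left out, so that the condition can be transported to the dual and
  to the glued body before anything else is known about the latter.
\<close>

definition normalized :: "real \<Rightarrow> (real^2) set \<Rightarrow> bool" where
  "normalized a K \<longleftrightarrow>
     a > 0 \<and> vector [a, 0] \<in> K \<and> vector [- 1 / a, 0] \<in> K \<and>
     (\<forall>x\<in>K. - 1 / a \<le> x $ 1 \<and> x $ 1 \<le> a)"

lemma vector_axis: "vector [c, 0] = c *\<^sub>R (vector [1, 0] :: real^2)"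
  by (simp add: vec_eq_iff forall_2)

lemma axis_normalized_imp_normalized:
  assumes "axis_normalized K"
  obtains a where "normalized a K"
proof -
  let ?e = "vector [1, 0] :: real^2"
  obtain l where l: "radial_function K ?e = exp l" "support_function K ?e = exp l"
      "radial_function K (- ?e) = exp (- l)" "support_function K (- ?e) = exp (- l)"
    and K: "compact K" "0 \<in> interior K"
    using assms by (auto simp: axis_normalized_def convex_body_def)
  have e: "?e \<noteq> 0" "- ?e \<noteq> 0"
    by (auto simp: vec_eq_iff forall_2)
  have 0: "0 \<in> K"
    using K(2) interior_subset by blast
  have inv: "exp (- l) = 1 / exp l"
    by (simp add: exp_minus field_simps)
  have "vector [exp l, 0] \<in> K"
    using radial_function_attained[OF K(1) 0 e(1)] l by (simp add: vector_axis[of "exp l"])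
  moreover have "vector [- 1 / exp l, 0] \<in> K"
    using radial_function_attained[OF K(1) 0 e(2)] l
    by (simp add: vector_axis[of "- (1 / exp l)"] inv)
  moreover have "- 1 / exp l \<le> x $ 1 \<and> x $ 1 \<le> exp l" if "x \<in> K" for x
    using inner_le_support_function[OF compact_imp_bounded[OF K(1)] that, of ?e]
      inner_le_support_function[OF compact_imp_bounded[OF K(1)] that, of "- ?e"] l
    by (simp add: inner_vec2 inv)
  ultimately have "normalized (exp l) K"
    by (simp add: normalized_def)
  then show thesis by (rule that)
qed

text \<open>
  Testing against the two axis points of \<open>K\<close> confines the dual to the strip, and the strip
  condition on \<open>K\<close> says that the axis points satisfy the inequalities defining the dual.
\<close>

lemma normalized_dual:
  assumes "normalized a K"
  shows "normalized a (dual_body K)"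
proof -
  have a: "a > 0" "vector [a, 0] \<in> K" "vector [- 1 / a, 0] \<in> K"
      "\<And>x. x \<in> K \<Longrightarrow> - 1 / a \<le> x $ 1" "\<And>x. x \<in> K \<Longrightarrow> x $ 1 \<le> a"
    using assms by (auto simp: normalized_def)
  have "vector [a, 0] \<in> dual_body K"
    using a(1,4) by (force simp: mem_dual_body inner_vec2 field_simps)
  moreover have "vector [- 1 / a, 0] \<in> dual_body K"
    using a(1,5) by (force simp: mem_dual_body inner_vec2 field_simps)
  moreover have "- 1 / a \<le> u $ 1 \<and> u $ 1 \<le> a" if u: "u \<in> dual_body K" for u
  proof -
    have "1 + u \<bullet> vector [a, 0] \<ge> 0" "1 + u \<bullet> vector [- 1 / a, 0] \<ge> 0"
      using u a(2,3) by (simp_all only: mem_dual_body)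
    then show ?thesis
      using a(1) by (simp add: inner_vec2 field_simps)
  qed
  ultimately show ?thesis
    using a(1) by (simp add: normalized_def)
qed

lemma normalized_axis_point:
  assumes K: "normalized a K" "convex K"
    and r: "r $ 2 = 0" "- 1 / a \<le> r $ 1" "r $ 1 \<le> a"
  shows "r \<in> K"
proof -
  let ?f = "\<lambda>t. vector [t, 0] :: real^2"
  have "linear ?f"
    by (intro linearI) (auto simp: vec_eq_iff forall_2)
  then have "closed_segment (?f (- 1 / a)) (?f a) = ?f ` closed_segment (- 1 / a) a"
    by (rule closed_segment_linear_image)
  moreover have "r = ?f (r $ 1)"
    using r(1) by (simp add: vec_eq_iff forall_2)
  moreover have "r $ 1 \<in> closed_segment (- 1 / a) a"
    using r(2,3) by (simp add: closed_segment_eq_real_ivl)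
  ultimately have "r \<in> closed_segment (?f (- 1 / a)) (?f a)"
    by (metis image_eqI)
  moreover have "closed_segment (?f (- 1 / a)) (?f a) \<subseteq> K"
    using K by (intro closed_segment_subset) (auto simp: normalized_def)
  ultimately show ?thesis by blast
qed

lemma strip_same_side:
  fixes u v :: "real^2"
  assumes a: "a > 0"
    and u: "- 1 / a \<le> u $ 1" "u $ 1 \<le> a" and v: "- 1 / a \<le> v $ 1" "v $ 1 \<le> a"
    and side: "u $ 2 * v $ 2 \<ge> 0"
  shows "1 + u \<bullet> v \<ge> 0"
proof -
  have *: "- 1 \<le> s * t" if "- 1 / a \<le> s" "s \<le> 0" "0 \<le> t" "t \<le> a" for s t :: real
  proof -
    have "- s * t \<le> 1 / a * a"
      using that a by (intro mult_mono) auto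
    then show ?thesis using a by simp
  qed
  have "- 1 \<le> u $ 1 * v $ 1"
  proof (cases "u $ 1 \<ge> 0"; cases "v $ 1 \<ge> 0")
    assume "u $ 1 \<ge> 0" "v $ 1 \<ge> 0"
    then have "0 \<le> u $ 1 * v $ 1" by simp
    then show ?thesis by linarith
  next
    assume "\<not> u $ 1 \<ge> 0" "\<not> v $ 1 \<ge> 0"
    then have "0 \<le> u $ 1 * v $ 1" by (simp add: mult_nonpos_nonpos)
    then show ?thesis by linarith
  qed (use *[of "u $ 1" "v $ 1"] *[of "v $ 1" "u $ 1"] u v in \<open>auto simp: mult.commute\<close>)
  then show ?thesis
    using side by (simp add: inner_vec2)
qed

abbreviation glued :: "(real^2) set \<Rightarrow> (real^2) set" where
  "glued K \<equiv> (K \<inter> upper_half) \<union> (dual_body K \<inter> lower_half)"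

lemma upper_half_halfspace: "upper_half = {p. axis 2 1 \<bullet> p \<ge> 0}"
  and lower_half_halfspace: "lower_half = {p. axis 2 1 \<bullet> p \<le> 0}"
  by (auto simp: upper_half_def lower_half_def inner_axis')

lemma convex_glued:
  assumes K: "normalized a K" "convex K"
  shows "convex (glued K)"
proof -
  let ?D = "dual_body K"
  have D: "normalized a ?D" "convex ?D"
    using normalized_dual[OF K(1)] convex_dual_body by auto
  have up: "convex (K \<inter> upper_half)" and low: "convex (?D \<inter> lower_half)"
    using K(2) D(2)
    by (auto simp: upper_half_halfspace lower_half_halfspace
        intro!: convex_Int convex_halfspace_ge convex_halfspace_le)
  have mixed: "closed_segment p q \<subseteq> glued K"
    if p: "p \<in> K \<inter> upper_half" and q: "q \<in> ?D \<inter> lower_half" for p q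
  proof -
    have "q $ 2 \<le> 0" "0 \<le> p $ 2"
      using p q by (auto simp: upper_half_def lower_half_def)
    then obtain r where r: "r \<in> closed_segment p q" "r $ 2 = 0"
      using connected_ivt_component_cart[of "closed_segment p q" q p 2 0] by auto
    \<comment> \<open>The crossing point inherits the strip bounds from \<open>p\<close> and \<open>q\<close>, which puts it in both bodies
      although \<open>p\<close> and \<open>q\<close> belong to different ones.\<close>
    have "r $ 1 \<in> closed_segment (p $ 1) (q $ 1)"
      using r(1) closed_segment_linear_image[of "\<lambda>x. x $ 1" p q]
      by (auto simp: linear_iff)
    moreover have "closed_segment (p $ 1) (q $ 1) \<subseteq> {- 1 / a..a}"
      using p q K(1) D(1) by (intro closed_segment_subset) (auto simp: normalized_def)
    ultimately have "- 1 / a \<le> r $ 1" "r $ 1 \<le> a"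
      by auto
    then have "r \<in> K" "r \<in> ?D"
      using normalized_axis_point K D r(2) by blast+
    moreover have "r \<in> upper_half" "r \<in> lower_half"
      using r(2) by (auto simp: upper_half_def lower_half_def)
    ultimately have "closed_segment p r \<subseteq> K \<inter> upper_half"
      "closed_segment r q \<subseteq> ?D \<inter> lower_half"
      using p q up low by (meson IntI closed_segment_subset)+
    then show ?thesis
      using Un_closed_segment[OF r(1)] by blast
  qed
  show ?thesis
    unfolding convex_contains_segment
  proof (intro ballI)
    fix p q assume "p \<in> glued K" "q \<in> glued K"
    then consider "p \<in> K \<inter> upper_half" "q \<in> K \<inter> upper_half"
      | "p \<in> ?D \<inter> lower_half" "q \<in> ?D \<inter> lower_half"
      | "p \<in> K \<inter> upper_half" "q \<in> ?D \<inter> lower_half"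
      | "q \<in> K \<inter> upper_half" "p \<in> ?D \<inter> lower_half"
      by blast
    then show "closed_segment p q \<subseteq> glued K"
    proof cases
      case 1
      then show ?thesis using closed_segment_subset[OF _ _ up] by blast
    next
      case 2
      then show ?thesis using closed_segment_subset[OF _ _ low] by blast
    next
      case 3
      then show ?thesis by (rule mixed)
    next
      case 4
      then show ?thesis using mixed by (metis closed_segment_commute)
    qed
  qed
qed

lemma compact_glued:
  assumes "compact K" "0 \<in> interior K"
  shows "compact (glued K)"
proof -
  have "compact (dual_body K)"
    using closed_dual_body bounded_dual_body[OF assms(2)] by (simp add: compact_eq_bounded_closed)
  then show ?thesis
    using assms(1) unfolding upper_half_halfspace lower_half_halfspace
    by (intro compact_Un compact_Int_closed closed_halfspace_ge closed_halfspace_le)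
qed

text \<open>
  Membership of a point \<open>u\<close> in \<open>K\<close> is decided by the points of the dual: those below the axis
  lie in the glued body, and for those above it the strip bound is enough if \<open>u\<close> is above it too.
  The case of \<open>u\<close> below the axis is the same with \<open>K\<close> and its dual exchanged.
\<close>

lemma self_dual_glued:
  assumes K: "normalized a K" "closed K" "convex K" "0 \<in> K"
  shows "self_dual (glued K)"
proof -
  let ?D = "dual_body K"
  have a: "a > 0"
    using K(1) by (simp add: normalized_def)
  have D: "normalized a ?D"
    using normalized_dual[OF K(1)] .
  have "normalized a (glued K)"
    using K(1) D by (auto simp: normalized_def upper_half_def lower_half_def)
  then have "normalized a (dual_body (glued K))"
    by (rule normalized_dual)
  then have side: "1 + u \<bullet> v \<ge> 0"
    if "u \<in> K \<union> ?D \<union> dual_body (glued K)" "v \<in> K \<union> ?D" "u $ 2 * v $ 2 \<ge> 0" for u v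
    using that K(1) D by (intro strip_same_side[OF a]) (auto simp: normalized_def)
  have "u \<in> dual_body (glued K)" if "u \<in> glued K" for u
    unfolding mem_dual_body
  proof
    fix v assume "v \<in> glued K"
    with that consider "u \<in> K" "v \<in> ?D" | "u \<in> ?D" "v \<in> K"
      | "u \<in> K \<union> ?D" "v \<in> K \<union> ?D" "u $ 2 * v $ 2 \<ge> 0"
      by (auto simp: upper_half_def lower_half_def mult_nonpos_nonpos)
    then show "1 + u \<bullet> v \<ge> 0"
    proof cases
      case 1
      then show ?thesis using mem_dual_body inner_commute by metis
    next
      case 2
      then show ?thesis using mem_dual_body by metis
    next
      case 3
      then show ?thesis using side by blast
    qed
  qed
  moreover have "u \<in> glued K" if u: "u \<in> dual_body (glued K)" for u
  proof (cases "u $ 2 \<ge> 0")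
    case True
    have "1 + u \<bullet> v \<ge> 0" if v: "v \<in> ?D" for v
    proof (cases "v $ 2 \<ge> 0")
      case vpos: True
      then show ?thesis using True u v side by simp
    next
      case False
      then have "v \<in> glued K" using v by (simp add: lower_half_def)
      then show ?thesis using u by (simp only: mem_dual_body)
    qed
    then have "u \<in> dual_body ?D"
      unfolding mem_dual_body[of u] by blast
    then have "u \<in> K"
      using K bipolar by blast
    then show ?thesis using True by (simp add: upper_half_def)
  next
    case False
    have "1 + u \<bullet> v \<ge> 0" if v: "v \<in> K" for v
    proof (cases "v $ 2 \<ge> 0")
      case True
      then have "v \<in> glued K" using v by (simp add: upper_half_def)
      then show ?thesis using u by (simp only: mem_dual_body)
    next
      case vneg: False
      then show ?thesis using False u v side by (simp add: mult_nonpos_nonpos)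
    qed
    then have "u \<in> ?D"
      unfolding mem_dual_body[of u] by blast
    then show ?thesis using False by (simp add: lower_half_def)
  qed
  ultimately show ?thesis
    unfolding self_dual_def by blast
qed

section \<open>The direction of a farthest point\<close>

lemma dual_body_orthogonal_image:
  assumes f: "orthogonal_transformation f"
  shows "dual_body (f ` K) = f ` dual_body K"
proof -
  have inner: "f x \<bullet> f y = x \<bullet> y" for x y
    using f by (simp add: orthogonal_transformation_def)
  have "u \<in> dual_body (f ` K) \<Longrightarrow> u \<in> f ` dual_body K" for u
  proof -
    assume u: "u \<in> dual_body (f ` K)"
    obtain w where "u = f w"
      using orthogonal_transformation_surj[OF f] by (metis surjD)
    with u show ?thesis
      by (auto simp: mem_dual_body inner)
  qed
  then show ?thesis
    by (auto simp: mem_dual_body inner)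
qed

lemma axis_normalized_farthest:
  assumes K: "convex_body K" "self_dual K"
    and p: "vector [a, 0] \<in> K" "a > 0" and far: "\<And>x. x \<in> K \<Longrightarrow> norm x \<le> a"
  shows "axis_normalized K"
proof -
  let ?e = "vector [1, 0] :: real^2"
  have sd: "dual_body K = K"
    using K(2) by (simp add: self_dual_def)
  have coord: "x \<bullet> ?e = x $ 1" for x
    by (simp add: inner_vec2)
  have right: "x $ 1 \<le> a" if "x \<in> K" for x
    using far[OF that] component_le_norm_cart[of x 1] by linarith
  have left: "- 1 / a \<le> x $ 1" if "x \<in> K" for x
  proof -
    have "1 + x \<bullet> vector [a, 0] \<ge> 0"
      using that p(1) mem_dual_body sd by metis
    then show ?thesis
      using p(2) by (simp add: inner_vec2 field_simps)
  qed
  \<comment> \<open>The line through \<open>(a, 0)\<close> orthogonal to the axis supports \<open>K\<close>, since \<open>K\<close> lies in the disc of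
    radius \<open>a\<close>; \<open>(- 1 / a, 0)\<close> is the point dual to this line.\<close>
  have q: "vector [- 1 / a, 0] \<in> K"
  proof -
    have "vector [- 1 / a, 0] \<in> dual_body K"
      using right p(2) by (force simp: mem_dual_body inner_vec2 field_simps)
    then show ?thesis using sd by simp
  qed
  have "support_function K ?e = a"
    using p right by (intro support_function_eqI[of "vector [a, 0]"]) (auto simp: coord)
  moreover have "support_function K (- ?e) = 1 / a"
    using q left by (intro support_function_eqI[of "vector [- 1 / a, 0]"])
      (force simp: coord)+
  moreover have "radial_function K ?e = a"
    using p right by (intro radial_function_eqI) (force simp: vector_axis[of a])+
  moreover have "radial_function K (- ?e) = 1 / a"
    using p(2) q left
    by (intro radial_function_eqI) (force simp: vector_axis[of "- (1 / a)"])+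
  moreover have "exp (ln a) = a" "exp (- ln a) = 1 / a"
    using p(2) by (auto simp: exp_minus field_simps)
  moreover have "0 \<in> interior K"
    using zero_interior_dual_body[of K] K(1) sd
    by (simp add: convex_body_def compact_imp_bounded)
  ultimately show ?thesis
    using K(1) unfolding axis_normalized_def by (intro conjI exI[of _ "ln a"]) auto
qed

lemma self_dual_rotate_axis_normalized:
  assumes K: "convex_body K" "self_dual K"
  obtains A :: "real^2^2" where "rotation_matrix A" "axis_normalized ((*v) A ` K)"
proof -
  have sd: "dual_body K = K"
    using K(2) by (simp add: self_dual_def)
  have K': "compact K" "convex K"
    using K(1) by (auto simp: convex_body_def)
  have int: "0 \<in> interior K"
    using zero_interior_dual_body[of K] compact_imp_bounded[OF K'(1)] sd by simp
  then have "K \<noteq> {}"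
    by auto
  then obtain p where p: "p \<in> K" "\<And>x. x \<in> K \<Longrightarrow> norm x \<le> norm p"
    using continuous_attains_sup[OF K'(1), of norm] continuous_on_norm_id by blast
  have "norm p > 0"
  proof -
    have "K \<noteq> {0}" using int by force
    then obtain x where "x \<in> K" "x \<noteq> 0" using p(1) by blast
    then show ?thesis using p(2)[of x] by (metis zero_less_norm_iff less_le_trans)
  qed
  obtain f where f: "orthogonal_transformation f" "det (matrix f) = 1"
      "f p = norm p *\<^sub>R axis 1 1"
    using rotation_exists[of p "norm p *\<^sub>R axis 1 1"] by auto
  define A where "A = matrix f"
  have A: "(*v) A = f"
    using f(1) unfolding A_def
    by (intro ext) (simp add: matrix_works orthogonal_transformation_linear)
  have lin: "linear f"
    using f(1) by (rule orthogonal_transformation_linear)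
  have "rotation_matrix A"
    using f(1,2) by (simp add: rotation_matrix_def A_def orthogonal_transformation_matrix)
  moreover have "axis_normalized ((*v) A ` K)"
    unfolding A
  proof (rule axis_normalized_farthest)
    show "convex_body (f ` K)"
      using K' lin by (auto simp: convex_body_def convex_linear_image
          intro!: compact_continuous_image linear_continuous_on linear_conv_bounded_linear[THEN iffD1])
    show "self_dual (f ` K)"
      using dual_body_orthogonal_image[OF f(1), of K] sd by (simp add: self_dual_def)
    have "vector [norm p, 0] = f p"
      by (simp add: f(3) vec_eq_iff forall_2 axis_def)
    then show "vector [norm p, 0] \<in> f ` K"
      using p(1) by simp
    show "norm p > 0" by fact
    show "norm x \<le> norm p" if "x \<in> f ` K" for x
      using that p(2) orthogonal_transformation_norm[OF f(1)] by auto
  qed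
  ultimately show thesis by (rule that)
qed

theorem mainTheorem5:
  shows "(\<forall>K :: (real^2) set. axis_normalized K \<longrightarrow>
            convex_body ((K \<inter> upper_half) \<union> (dual_body K \<inter> lower_half)) \<and>
            self_dual ((K \<inter> upper_half) \<union> (dual_body K \<inter> lower_half)))
       \<and> (\<forall>K :: (real^2) set. convex_body K \<and> self_dual K \<longrightarrow>
            (\<exists>A :: real^2^2. rotation_matrix A \<and> axis_normalized ((\<lambda>x. A *v x) ` K)))"
proof (intro conjI allI impI)
  fix K assume K: "axis_normalized K"
  then have K': "compact K" "convex K" "0 \<in> interior K"
    by (auto simp: axis_normalized_def convex_body_def)
  obtain a where a: "normalized a K"
    using axis_normalized_imp_normalized[OF K] .
  show "convex_body (glued K)"
    using compact_glued[OF K'(1,3)] convex_glued[OF a K'(2)] by (simp add: convex_body_def)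
  show "self_dual (glued K)"
    using self_dual_glued[OF a] K' interior_subset by (blast intro: compact_imp_closed)
next
  fix K :: "(real^2) set" assume "convex_body K \<and> self_dual K"
  then show "\<exists>A :: real^2^2. rotation_matrix A \<and> axis_normalized ((\<lambda>x. A *v x) ` K)"
    using self_dual_rotate_axis_normalized by metis
qed

end
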